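(* Let $\mathcal{C}$ be a pointed category and let $(\mathcal{T}_1,\mathcal{F}_1)$ and $(\mathcal{T}_2,\mathcal{F}_2)$ be two torsion theories in $\mathcal{C}$. Then the following conditions are equivalent: (1) $\mathcal{T}_2\subseteq \mathcal{T}_1$; (2) $\mathcal{F}_1\subseteq \mathcal{F}_2$; (3) $(\mathcal{T}_1,\mathcal{F}_2)$ is a pretorsion theory in $\mathcal{C}$. Moreover, if these conditions hold, then $\mathcal{T}_1=\mathcal{T}_2\ast\mathcal{Z}$ and $\mathcal{F}_2=\mathcal{Z}\ast\mathcal{F}_1$, where $\mathcal{Z}:=\mathcal{T}_1\cap\mathcal{F}_2$.
   Context: A pointed category is a category with a zero object. In a pointed category, a short exact sequence $0\to A\xrightarrow{f}B\xrightarrow{g}C\to 0$ is a pair of composable morphisms such that $f$ is a kernel of $g$ and $g$ is a cokernel of $f$. Torsion theory: a torsion theory in a pointed category $\mathcal{C}$ is a pair $(\mathcal{T},\mathcal{F})$ of full subcategories of $\mathcal{C}$ closed under isomorphisms such that (i) every morphism from an object of $\mathcal{T}$ to an object of $\mathcal{F}$ is zero; (ii) for every object $X$ of $\mathcal{C}$ there is a short exact sequence $0\to T_X\to X\to F_X\to 0$ with $T_X\in\mathcal{T}$ and $F_X\in\mathcal{F}$. $\mathcal{Z}$-trivial morphisms, $\mathcal{Z}$-kernels, $\mathcal{Z}$-cokernels: let $\mathcal{C}$ be any category and $\mathcal{Z}$ a class of objects of $\mathcal{C}$. A morphism is $\mathcal{Z}$-trivial if it factors through an object of $\mathcal{Z}$;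 $\mathrm{Triv}(X,Y)$ denotes the class of $\mathcal{Z}$-trivial morphisms $X\to Y$. A morphism $\varepsilon\colon X\to A$ is a $\mathcal{Z}$-kernel of $f\colon A\to A'$ if $f\varepsilon$ is $\mathcal{Z}$-trivial and, whenever $\lambda\colon Y\to A$ is such that $f\lambda$ is $\mathcal{Z}$-trivial, there is a unique $\lambda'\colon Y\to X$ with $\lambda=\varepsilon\lambda'$. $\mathcal{Z}$-cokernels are defined dually. A sequence $A\xrightarrow{f}B\xrightarrow{g}C$ is a short $\mathcal{Z}$-exact sequence if $f$ is a $\mathcal{Z}$-kernel of $g$ and $g$ is a $\mathcal{Z}$-cokernel of $f$. Pretorsion theory: a pair $(\mathcal{T},\mathcal{F})$ of full subcategories of a category $\mathcal{C}$ closed under isomorphisms is a pretorsion theory in $\mathcal{C}$ with class of trivial objects $\mathcal{Z}:=\mathcal{T}\cap\mathcal{F}$ if (i) $\mathrm{Hom}(T,F)=\mathrm{Triv}(T,F)$ for all $T\in\mathcal{T}$, $F\in\mathcal{F}$; (ii) for every object $X$ of $\mathcal{C}$ there is a short $\mathcal{Z}$-exact sequence $T_X\to X\to F_X$ with $T_X\in\mathcal{T}$ and $F_X\in\mathcal{F}$. Extensions: for subcategories $\mathcal{A},\mathcal{B}$ of a pointed category $\mathcal{C}$, $\mathcal{A}\ast\mathcal{B}$ denotes the full subcategory of $\mathcal{C}$ of those objects $X$ for which there is a short exact sequence $0\to A\to X\to B\to 0$ with $A\in\mathcal{A}$ and $B\in\mathcal{B}$. *)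

theory Defs
  imports Main
begin

text \<open>
  A full subcategory is given by its set of objects.  Composition is written in the order of the
  mathematics: \<open>g \<cdot> f\<close> is \<open>f\<close> followed by \<open>g\<close>.  It is constrained only on composable pairs.
\<close>

record ('o, 'a) category =
  Obj :: "'o set"
  Arr :: "'a set"
  Dom :: "'a \<Rightarrow> 'o"
  Cod :: "'a \<Rightarrow> 'o"
  Ident :: "'o \<Rightarrow> 'a"
  Comp :: "'a \<Rightarrow> 'a \<Rightarrow> 'a" (infixr "\<cdot>\<index>" 70)

definition Hom :: "('o, 'a) category \<Rightarrow> 'o \<Rightarrow> 'o \<Rightarrow> 'a set" where
  "Hom C X Y = {f \<in> Arr C. Dom C f = X \<and> Cod C f = Y}"

locale category =
  fixes C :: "('o, 'a) category" (structure)
  assumes Dom_in_Obj: "f \<in> Arr C \<Longrightarrow> Dom C f \<in> Obj C"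
    and Cod_in_Obj: "f \<in> Arr C \<Longrightarrow> Cod C f \<in> Obj C"
    and Ident_in_Hom: "X \<in> Obj C \<Longrightarrow> Ident C X \<in> Hom C X X"
    and Comp_in_Hom: "f \<in> Hom C X Y \<Longrightarrow> g \<in> Hom C Y Z \<Longrightarrow> g \<cdot> f \<in> Hom C X Z"
    and Comp_Ident: "f \<in> Hom C X Y \<Longrightarrow> f \<cdot> Ident C X = f"
    and Ident_Comp: "f \<in> Hom C X Y \<Longrightarrow> Ident C Y \<cdot> f = f"
    and Comp_assoc: "f \<in> Hom C W X \<Longrightarrow> g \<in> Hom C X Y \<Longrightarrow> h \<in> Hom C Y Z \<Longrightarrow>
      (h \<cdot> g) \<cdot> f = h \<cdot> (g \<cdot> f)"

definition isomorphic :: "('o, 'a) category \<Rightarrow> 'o \<Rightarrow> 'o \<Rightarrow> bool" where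
  "isomorphic C X Y \<longleftrightarrow>
    (\<exists>f \<in> Hom C X Y. \<exists>g \<in> Hom C Y X. g \<cdot>\<^bsub>C\<^esub> f = Ident C X \<and> f \<cdot>\<^bsub>C\<^esub> g = Ident C Y)"

definition iso_closed :: "('o, 'a) category \<Rightarrow> 'o set \<Rightarrow> bool" where
  "iso_closed C S \<longleftrightarrow> S \<subseteq> Obj C \<and> (\<forall>X\<in>S. \<forall>Y\<in>Obj C. isomorphic C X Y \<longrightarrow> Y \<in> S)"

definition zero_object :: "('o, 'a) category \<Rightarrow> 'o \<Rightarrow> bool" where
  "zero_object C Z \<longleftrightarrow> Z \<in> Obj C \<and>
    (\<forall>X\<in>Obj C. (\<exists>!f. f \<in> Hom C Z X) \<and> (\<exists>!f. f \<in> Hom C X Z))"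

locale pointed_category = category +
  assumes ex_zero_object: "\<exists>Z. zero_object C Z"

definition zero_morphism :: "('o, 'a) category \<Rightarrow> 'a \<Rightarrow> bool" where
  "zero_morphism C f \<longleftrightarrow> f \<in> Arr C \<and>
    (\<exists>Z. zero_object C Z \<and> (\<exists>h \<in> Hom C (Dom C f) Z. \<exists>k \<in> Hom C Z (Cod C f). f = k \<cdot>\<^bsub>C\<^esub> h))"

text \<open>\<open>is_kernel C e f\<close>: the arrow \<open>e\<close> is a kernel of \<open>f\<close>.
  \<open>is_cokernel C p f\<close>: the arrow \<open>p\<close> is a cokernel of \<open>f\<close>.\<close>

definition is_kernel :: "('o, 'a) category \<Rightarrow> 'a \<Rightarrow> 'a \<Rightarrow> bool" where
  "is_kernel C e f \<longleftrightarrow> e \<in> Arr C \<and> f \<in> Arr C \<and> Cod C e = Dom C f \<and> zero_morphism C (f \<cdot>\<^bsub>C\<^esub> e) \<and>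
    (\<forall>l \<in> Arr C. Cod C l = Dom C f \<and> zero_morphism C (f \<cdot>\<^bsub>C\<^esub> l) \<longrightarrow>
      (\<exists>!l'. l' \<in> Hom C (Dom C l) (Dom C e) \<and> l = e \<cdot>\<^bsub>C\<^esub> l'))"

definition is_cokernel :: "('o, 'a) category \<Rightarrow> 'a \<Rightarrow> 'a \<Rightarrow> bool" where
  "is_cokernel C p f \<longleftrightarrow> p \<in> Arr C \<and> f \<in> Arr C \<and> Dom C p = Cod C f \<and> zero_morphism C (p \<cdot>\<^bsub>C\<^esub> f) \<and>
    (\<forall>l \<in> Arr C. Dom C l = Cod C f \<and> zero_morphism C (l \<cdot>\<^bsub>C\<^esub> f) \<longrightarrow>
      (\<exists>!l'. l' \<in> Hom C (Cod C p) (Cod C l) \<and> l = l' \<cdot>\<^bsub>C\<^esub> p))"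

definition short_exact :: "('o, 'a) category \<Rightarrow> 'o \<Rightarrow> 'a \<Rightarrow> 'o \<Rightarrow> 'a \<Rightarrow> 'o \<Rightarrow> bool" where
  "short_exact C A f B g D \<longleftrightarrow>
    f \<in> Hom C A B \<and> g \<in> Hom C B D \<and> is_kernel C f g \<and> is_cokernel C g f"

definition torsion_theory :: "('o, 'a) category \<Rightarrow> 'o set \<Rightarrow> 'o set \<Rightarrow> bool" where
  "torsion_theory C \<T> \<F> \<longleftrightarrow> iso_closed C \<T> \<and> iso_closed C \<F> \<and>
    (\<forall>T\<in>\<T>. \<forall>F\<in>\<F>. \<forall>f \<in> Hom C T F. zero_morphism C f) \<and>
    (\<forall>X\<in>Obj C. \<exists>T\<in>\<T>. \<exists>F\<in>\<F>. \<exists>f g. short_exact C T f X g F)"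

definition extensions :: "('o, 'a) category \<Rightarrow> 'o set \<Rightarrow> 'o set \<Rightarrow> 'o set" where
  "extensions C \<A> \<B> = {X \<in> Obj C. \<exists>A\<in>\<A>. \<exists>B\<in>\<B>. \<exists>f g. short_exact C A f X g B}"

definition Triv :: "('o, 'a) category \<Rightarrow> 'o set \<Rightarrow> 'o \<Rightarrow> 'o \<Rightarrow> 'a set" where
  "Triv C \<Z> X Y = {f \<in> Hom C X Y. \<exists>Z\<in>\<Z>. \<exists>h \<in> Hom C X Z. \<exists>k \<in> Hom C Z Y. f = k \<cdot>\<^bsub>C\<^esub> h}"

definition trivial_morphism :: "('o, 'a) category \<Rightarrow> 'o set \<Rightarrow> 'a \<Rightarrow> bool" where
  "trivial_morphism C \<Z> f \<longleftrightarrow> f \<in> Triv C \<Z> (Dom C f) (Cod C f)"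

definition is_Z_kernel :: "('o, 'a) category \<Rightarrow> 'o set \<Rightarrow> 'a \<Rightarrow> 'a \<Rightarrow> bool" where
  "is_Z_kernel C \<Z> e f \<longleftrightarrow>
    e \<in> Arr C \<and> f \<in> Arr C \<and> Cod C e = Dom C f \<and> trivial_morphism C \<Z> (f \<cdot>\<^bsub>C\<^esub> e) \<and>
    (\<forall>l \<in> Arr C. Cod C l = Dom C f \<and> trivial_morphism C \<Z> (f \<cdot>\<^bsub>C\<^esub> l) \<longrightarrow>
      (\<exists>!l'. l' \<in> Hom C (Dom C l) (Dom C e) \<and> l = e \<cdot>\<^bsub>C\<^esub> l'))"

definition is_Z_cokernel :: "('o, 'a) category \<Rightarrow> 'o set \<Rightarrow> 'a \<Rightarrow> 'a \<Rightarrow> bool" where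
  "is_Z_cokernel C \<Z> p f \<longleftrightarrow>
    p \<in> Arr C \<and> f \<in> Arr C \<and> Dom C p = Cod C f \<and> trivial_morphism C \<Z> (p \<cdot>\<^bsub>C\<^esub> f) \<and>
    (\<forall>l \<in> Arr C. Dom C l = Cod C f \<and> trivial_morphism C \<Z> (l \<cdot>\<^bsub>C\<^esub> f) \<longrightarrow>
      (\<exists>!l'. l' \<in> Hom C (Cod C p) (Cod C l) \<and> l = l' \<cdot>\<^bsub>C\<^esub> p))"

definition short_Z_exact ::
  "('o, 'a) category \<Rightarrow> 'o set \<Rightarrow> 'o \<Rightarrow> 'a \<Rightarrow> 'o \<Rightarrow> 'a \<Rightarrow> 'o \<Rightarrow> bool" where
  "short_Z_exact C \<Z> A f B g D \<longleftrightarrow>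
    f \<in> Hom C A B \<and> g \<in> Hom C B D \<and> is_Z_kernel C \<Z> f g \<and> is_Z_cokernel C \<Z> g f"

definition pretorsion_theory :: "('o, 'a) category \<Rightarrow> 'o set \<Rightarrow> 'o set \<Rightarrow> bool" where
  "pretorsion_theory C \<T> \<F> \<longleftrightarrow> iso_closed C \<T> \<and> iso_closed C \<F> \<and>
    (\<forall>T\<in>\<T>. \<forall>F\<in>\<F>. Hom C T F = Triv C (\<T> \<inter> \<F>) T F) \<and>
    (\<forall>X\<in>Obj C. \<exists>T\<in>\<T>. \<exists>F\<in>\<F>. \<exists>f g. short_Z_exact C (\<T> \<inter> \<F>) T f X g F)"

end

(* A torsion theory determines each of its classes from the other by vanishing of Hom, whence the
   equivalence of the two inclusions. Granted these, a morphism from T1 to F2 factors through the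
   F2-part of its domain, which is a quotient of an object of T1 and so lies in Z. The required
   Z-exact sequence for X combines the T1-part of X with its F2-part: the projection of X onto its
   F1-part p factors through its F2-part g, so if g l is Z-trivial, then p l factors through a
   morphism from Z to F1 and vanishes. Conversely, for X in T2 the F2-part of a Z-exact sequence is
   zero, so the identity of X factors through its T1-part. The dual halves are obtained by passing
   to the opposite category. *)

theory Submission
  imports Defs
begin

section \<open>Opposite categories and the duality of kernels and torsion theories\<close>

definition opposite :: "('o, 'a) category \<Rightarrow> ('o, 'a) category" where
  "opposite C = \<lparr>Obj = Obj C, Arr = Arr C, Dom = Cod C, Cod = Dom C, Ident = Ident C,
    Comp = \<lambda>g f. Comp C f g\<rparr>"

lemma opposite_simps [simp]:
  "Obj (opposite C) = Obj C" "Arr (opposite C) = Arr C"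
  "Dom (opposite C) = Cod C" "Cod (opposite C) = Dom C"
  "Ident (opposite C) = Ident C" "Comp (opposite C) g f = Comp C f g"
  by (simp_all add: opposite_def)

lemma Hom_opposite [simp]: "Hom (opposite C) X Y = Hom C Y X"
  by (auto simp: Hom_def)

lemma zero_object_opposite [simp]: "zero_object (opposite C) Z \<longleftrightarrow> zero_object C Z"
  by (auto simp: zero_object_def)

lemma zero_morphism_opposite [simp]: "zero_morphism (opposite C) f \<longleftrightarrow> zero_morphism C f"
  unfolding zero_morphism_def by auto

lemma iso_closed_opposite [simp]: "iso_closed (opposite C) S \<longleftrightarrow> iso_closed C S"
proof -
  have "isomorphic (opposite C) X Y \<longleftrightarrow> isomorphic C X Y" for X Y
    unfolding isomorphic_def by auto
  then show ?thesis unfolding iso_closed_def by simp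
qed

lemma is_kernel_opposite [simp]: "is_kernel (opposite C) e f \<longleftrightarrow> is_cokernel C e f"
  unfolding is_kernel_def is_cokernel_def by simp

lemma is_cokernel_opposite [simp]: "is_cokernel (opposite C) e f \<longleftrightarrow> is_kernel C e f"
  unfolding is_kernel_def is_cokernel_def by simp

lemma short_exact_opposite [simp]:
  "short_exact (opposite C) A f B g D \<longleftrightarrow> short_exact C D g B f A"
  unfolding short_exact_def by auto

text \<open>Reversing arrows exchanges the two classes, so a result on torsion classes, applied in
  \<open>opposite C\<close>, becomes one on torsion-free classes.\<close>

lemma torsion_theory_opposite [simp]:
  "torsion_theory (opposite C) \<F> \<T> \<longleftrightarrow> torsion_theory C \<T> \<F>"
  unfolding torsion_theory_def by simp blast

lemma extensions_opposite [simp]: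
  "extensions (opposite C) \<B> \<A> = extensions C \<A> \<B>"
  unfolding extensions_def by auto

lemma trivial_morphism_opposite [simp]:
  "trivial_morphism (opposite C) \<Z> f \<longleftrightarrow> trivial_morphism C \<Z> f"
  unfolding trivial_morphism_def Triv_def by auto

lemma is_Z_kernel_opposite [simp]: "is_Z_kernel (opposite C) \<Z> e f \<longleftrightarrow> is_Z_cokernel C \<Z> e f"
  unfolding is_Z_kernel_def is_Z_cokernel_def by simp

lemma ex1_eq: "\<exists>!x. P x \<Longrightarrow> P a \<Longrightarrow> P b \<Longrightarrow> a = b"
  by auto

lemma HomD:
  assumes "f \<in> Hom C X Y"
  shows "f \<in> Arr C" "Dom C f = X" "Cod C f = Y"
  using assms by (auto simp: Hom_def)

section \<open>Zero morphisms and short exact sequences\<close>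

context category
begin

lemma Hom_Obj:
  assumes "f \<in> Hom C X Y"
  shows "X \<in> Obj C" "Y \<in> Obj C"
  using assms Dom_in_Obj Cod_in_Obj by (auto simp: Hom_def)

lemma category_opposite: "category (opposite C)"
proof
  fix W X Y Z f g h
  assume "f \<in> Hom (opposite C) W X" "g \<in> Hom (opposite C) X Y" "h \<in> Hom (opposite C) Y Z"
  then show "Comp (opposite C) (Comp (opposite C) h g) f
      = Comp (opposite C) h (Comp (opposite C) g f)"
    using Comp_assoc[of h Z Y g X f W] by simp
qed (auto simp: Dom_in_Obj Cod_in_Obj Ident_in_Hom Comp_in_Hom Comp_Ident Ident_Comp)

lemma zero_morphism_Comp_left:
  assumes "zero_morphism C f" "f \<in> Hom C X Y" "g \<in> Hom C Y Z"
  shows "zero_morphism C (g \<cdot> f)"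
proof -
  obtain W h k where W: "zero_object C W" and h: "h \<in> Hom C X W" and k: "k \<in> Hom C W Y"
    and f: "f = k \<cdot> h"
    using assms(1) HomD[OF assms(2)] unfolding zero_morphism_def by auto
  have gf: "g \<cdot> f \<in> Hom C X Z" using Comp_in_Hom assms by blast
  have "g \<cdot> f = (g \<cdot> k) \<cdot> h" using Comp_assoc h k assms(3) f by simp
  moreover have "g \<cdot> k \<in> Hom C W Z" using Comp_in_Hom k assms(3) by blast
  ultimately show ?thesis unfolding zero_morphism_def using HomD[OF gf] W h by auto
qed

lemma zero_morphism_Comp_right:
  assumes "zero_morphism C f" "f \<in> Hom C Y Z" "g \<in> Hom C X Y"
  shows "zero_morphism C (f \<cdot> g)"
  using category.zero_morphism_Comp_left[OF category_opposite, of f Z Y g X] assms by simp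

lemma zero_object_unique:
  assumes "zero_object C Z"
  shows "f \<in> Hom C Z X \<Longrightarrow> g \<in> Hom C Z X \<Longrightarrow> f = g"
    and "f \<in> Hom C X Z \<Longrightarrow> g \<in> Hom C X Z \<Longrightarrow> f = g"
  using assms Hom_Obj unfolding zero_object_def by metis+

text \<open>The arrow \<open>u\<close> between the two zero objects links the two factorisations:
  both composites equal \<open>k' \<cdot> u \<cdot> h\<close>.\<close>

lemma zero_morphism_unique:
  assumes "zero_morphism C f" "zero_morphism C g" "f \<in> Hom C X Y" "g \<in> Hom C X Y"
  shows "f = g"
proof -
  obtain W h k where W: "zero_object C W" and h: "h \<in> Hom C X W" and k: "k \<in> Hom C W Y"
    and f: "f = k \<cdot> h"
    using assms(1) HomD[OF assms(3)] unfolding zero_morphism_def by auto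
  obtain W' h' k' where W': "zero_object C W'" and h': "h' \<in> Hom C X W'"
    and k': "k' \<in> Hom C W' Y" and g: "g = k' \<cdot> h'"
    using assms(2) HomD[OF assms(4)] unfolding zero_morphism_def by auto
  obtain u where u: "u \<in> Hom C W W'"
    using W W' unfolding zero_object_def by auto
  have "u \<cdot> h = h'"
    using zero_object_unique(2)[OF W' Comp_in_Hom[OF h u] h'] .
  moreover have "k' \<cdot> u = k"
    using zero_object_unique(1)[OF W Comp_in_Hom[OF u k'] k] .
  ultimately show ?thesis using Comp_assoc[OF h u k'] f g by simp
qed

lemma zero_morphism_zero_object:
  assumes "zero_object C Z" "f \<in> Hom C Z X"
  shows "zero_morphism C f"
proof -
  have "Ident C Z \<in> Hom C Z Z" using Ident_in_Hom Hom_Obj[OF assms(2)] by blast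
  moreover have "f = f \<cdot> Ident C Z" using Comp_Ident[OF assms(2)] by simp
  ultimately show ?thesis
    unfolding zero_morphism_def using assms HomD[OF assms(2)] by blast
qed

lemma short_exactD:
  assumes "short_exact C A f B g D"
  shows "f \<in> Hom C A B" "g \<in> Hom C B D" "zero_morphism C (g \<cdot> f)"
  using assms unfolding short_exact_def is_kernel_def by simp_all

text \<open>The universal property of the kernel, rephrased with hom-sets so that it can be applied
  as a rule.\<close>

lemma short_exact_kernel:
  assumes "short_exact C A f B g D" "l \<in> Hom C Y B" "zero_morphism C (g \<cdot> l)"
  shows "\<exists>!l'. l' \<in> Hom C Y A \<and> l = f \<cdot> l'"
proof -
  note fg = short_exactD(1,2)[OF assms(1)]
  have "\<forall>l \<in> Arr C. Cod C l = Dom C g \<and> zero_morphism C (g \<cdot> l) \<longrightarrow>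
      (\<exists>!l'. l' \<in> Hom C (Dom C l) (Dom C f) \<and> l = f \<cdot> l')"
    using assms(1) unfolding short_exact_def is_kernel_def by (elim conjE)
  from bspec[OF this HomD(1)[OF assms(2)]] show ?thesis
    using HomD[OF fg(1)] HomD[OF fg(2)] HomD[OF assms(2)] assms(3) by simp
qed

lemma short_exact_cokernel:
  assumes "short_exact C A f B g D" "l \<in> Hom C B Y" "zero_morphism C (l \<cdot> f)"
  shows "\<exists>!l'. l' \<in> Hom C D Y \<and> l = l' \<cdot> g"
  using category.short_exact_kernel[OF category_opposite, of D g B f A l Y] assms by simp

text \<open>Kernels are monic: \<open>u\<close> and \<open>v\<close> both factor the same arrow
  \<open>f \<cdot> u\<close>, which \<open>g\<close> kills, so uniqueness in the universal property
  identifies them.\<close>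

lemma short_exact_mono:
  assumes "short_exact C A f B g D" "u \<in> Hom C Y A" "v \<in> Hom C Y A" "f \<cdot> u = f \<cdot> v"
  shows "u = v"
proof -
  note f = short_exactD[OF assms(1)]
  have "zero_morphism C (g \<cdot> (f \<cdot> u))"
    using zero_morphism_Comp_right[OF f(3) Comp_in_Hom[OF f(1,2)] assms(2)]
      Comp_assoc[OF assms(2) f(1,2)] by simp
  from short_exact_kernel[OF assms(1) Comp_in_Hom[OF assms(2) f(1)] this] show ?thesis
    by (rule ex1_eq) (simp_all add: assms(2-4))
qed

lemma iso_closed_inverse_pair:
  assumes "iso_closed C S" "T \<in> S" "f \<in> Hom C T X" "s \<in> Hom C X T"
    and "f \<cdot> s = Ident C X" "s \<cdot> f = Ident C T"
  shows "X \<in> S"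
  using assms Hom_Obj[OF assms(3)] unfolding iso_closed_def isomorphic_def by blast

end

section \<open>Torsion classes in a pointed category\<close>

context pointed_category
begin

lemma pointed_category_opposite: "pointed_category (opposite C)"
  using category_opposite ex_zero_object
  by (simp add: pointed_category_def pointed_category_axioms_def)

lemma ex_zero_morphism:
  assumes "X \<in> Obj C" "Y \<in> Obj C"
  shows "\<exists>f \<in> Hom C X Y. zero_morphism C f"
proof -
  obtain Z where Z: "zero_object C Z" using ex_zero_object by blast
  obtain h where h: "h \<in> Hom C X Z"
    using Z assms(1) unfolding zero_object_def by auto
  obtain k where k: "k \<in> Hom C Z Y"
    using Z assms(2) unfolding zero_object_def by auto
  have "zero_morphism C (k \<cdot> h)"
    using zero_morphism_Comp_right[OF zero_morphism_zero_object[OF Z k] k h] .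
  then show ?thesis using Comp_in_Hom[OF h k] by blast
qed

text \<open>The cokernel \<open>g\<close> is epic, dually to \<open>short_exact_mono\<close>, and
  \<open>h\<close> agrees after precomposition with \<open>g\<close> with the zero arrow between the
  same objects.\<close>

lemma short_exact_epi_zero:
  assumes "short_exact C A f B g D" "h \<in> Hom C D Y" "zero_morphism C (h \<cdot> g)"
  shows "zero_morphism C h"
proof -
  note g = short_exactD[OF assms(1)]
  obtain z where z: "z \<in> Hom C D Y" "zero_morphism C z"
    using ex_zero_morphism Hom_Obj[OF assms(2)] by blast
  have "h \<cdot> g = z \<cdot> g"
    using zero_morphism_unique[OF assms(3) zero_morphism_Comp_right[OF z(2,1) g(2)]
      Comp_in_Hom[OF g(2) assms(2)] Comp_in_Hom[OF g(2) z(1)]] .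
  then have "h = z"
    using category.short_exact_mono[OF category_opposite, of D g B f A h Y z] assms(1,2) z(1)
    by simp
  then show ?thesis using z(2) by simp
qed

lemma torsion_theory_zero_morphism:
  assumes "torsion_theory C \<T> \<F>" "X \<in> \<T>" "Y \<in> \<F>" "f \<in> Hom C X Y"
  shows "zero_morphism C f"
  using assms unfolding torsion_theory_def by blast

lemma torsion_theory_Obj:
  assumes "torsion_theory C \<T> \<F>"
  shows "\<T> \<subseteq> Obj C" "\<F> \<subseteq> Obj C"
  using assms unfolding torsion_theory_def iso_closed_def by auto

lemma torsion_theory_short_exact:
  assumes "torsion_theory C \<T> \<F>" "X \<in> Obj C"
  obtains T F f g where "T \<in> \<T>" "F \<in> \<F>" "short_exact C T f X g F"
  using assms unfolding torsion_theory_def by blast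

text \<open>If the projection \<open>g\<close> onto the torsion-free part vanishes, the identity of
  \<open>X\<close> factors through the kernel \<open>f\<close>. Then \<open>f\<close> is a split
  epimorphism and monic, hence an isomorphism, and \<open>X\<close> inherits membership from its
  torsion part.\<close>

lemma torsion_memI:
  assumes tt: "torsion_theory C \<T> \<F>" and X: "X \<in> Obj C"
    and zero: "\<And>F f. F \<in> \<F> \<Longrightarrow> f \<in> Hom C X F \<Longrightarrow> zero_morphism C f"
  shows "X \<in> \<T>"
proof -
  obtain T F f g where T: "T \<in> \<T>" and F: "F \<in> \<F>" and ex: "short_exact C T f X g F"
    using torsion_theory_short_exact[OF tt X] .
  note fg = short_exactD[OF ex]
  have id: "Ident C X \<in> Hom C X X" "Ident C T \<in> Hom C T T"
    using Ident_in_Hom Hom_Obj[OF fg(1)] by auto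
  have "zero_morphism C (g \<cdot> Ident C X)" using zero[OF F fg(2)] Comp_Ident[OF fg(2)] by simp
  then obtain s where s: "s \<in> Hom C X T" "Ident C X = f \<cdot> s"
    using ex1_implies_ex[OF short_exact_kernel[OF ex id(1)]] by blast
  \<comment> \<open>Both sides equal \<open>f\<close>; cancelling the monic \<open>f\<close> yields
    the second inverse law.\<close>
  have "f \<cdot> (s \<cdot> f) = f \<cdot> Ident C T"
    using Comp_assoc[OF fg(1) s(1) fg(1)] s(2) Comp_Ident[OF fg(1)] Ident_Comp[OF fg(1)] by simp
  then have "s \<cdot> f = Ident C T"
    using short_exact_mono[OF ex Comp_in_Hom[OF fg(1) s(1)] id(2)] by blast
  then show ?thesis
    using iso_closed_inverse_pair[OF _ T fg(1) s(1)] s(2) tt unfolding torsion_theory_def by auto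
qed

text \<open>Arrows from an object of \<open>\<T>\<^sub>2\<close> into \<open>\<F>\<^sub>2\<close>
  vanish, in particular those into the smaller class \<open>\<F>\<^sub>1\<close>, so
  \<open>torsion_memI\<close> applies to the first theory.\<close>

lemma torsion_subset_if_torsionfree_subset:
  assumes t1: "torsion_theory C \<T>\<^sub>1 \<F>\<^sub>1" and t2: "torsion_theory C \<T>\<^sub>2 \<F>\<^sub>2" and "\<F>\<^sub>1 \<subseteq> \<F>\<^sub>2"
  shows "\<T>\<^sub>2 \<subseteq> \<T>\<^sub>1"
proof
  fix X assume X: "X \<in> \<T>\<^sub>2"
  then have "X \<in> Obj C" using torsion_theory_Obj[OF t2] by blast
  then show "X \<in> \<T>\<^sub>1"
    using torsion_memI[OF t1] torsion_theory_zero_morphism[OF t2 X] \<open>\<F>\<^sub>1 \<subseteq> \<F>\<^sub>2\<close> by blast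
qed

lemma torsion_subset_iff:
  assumes "torsion_theory C \<T>\<^sub>1 \<F>\<^sub>1" "torsion_theory C \<T>\<^sub>2 \<F>\<^sub>2"
  shows "\<T>\<^sub>2 \<subseteq> \<T>\<^sub>1 \<longleftrightarrow> \<F>\<^sub>1 \<subseteq> \<F>\<^sub>2"
  \<comment> \<open>The other implication is the same lemma in the opposite category, where
    \<open>(\<F>\<^sub>2, \<T>\<^sub>2)\<close> is the first theory and
    \<open>(\<F>\<^sub>1, \<T>\<^sub>1)\<close> the second.\<close>
  using torsion_subset_if_torsionfree_subset[OF assms]
    pointed_category.torsion_subset_if_torsionfree_subset
      [OF pointed_category_opposite, of \<F>\<^sub>2 \<T>\<^sub>2 \<F>\<^sub>1 \<T>\<^sub>1] assms by auto

text \<open>An arrow from \<open>Q\<close> to a torsion-free object vanishes once precomposed with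
  the epic \<open>g\<close>, so it is itself zero.\<close>

lemma torsion_quotient:
  assumes tt: "torsion_theory C \<T> \<F>" and ex: "short_exact C A f X g Q" and X: "X \<in> \<T>"
  shows "Q \<in> \<T>"
proof (rule torsion_memI[OF tt])
  note fg = short_exactD[OF ex]
  show "Q \<in> Obj C" using Hom_Obj[OF fg(2)] by simp
  fix F h assume "F \<in> \<F>" "h \<in> Hom C Q F"
  then show "zero_morphism C h"
    using short_exact_epi_zero[OF ex] torsion_theory_zero_morphism[OF tt X]
      Comp_in_Hom[OF fg(2)] by blast
qed

text \<open>An arrow from \<open>X\<close> to a torsion-free object kills \<open>A\<close>, hence
  factors through \<open>B\<close>, from which only zero arrows lead to torsion-free
  objects.\<close>

lemma torsion_extension:
  assumes tt: "torsion_theory C \<T> \<F>" and ex: "short_exact C A f X g B"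
    and A: "A \<in> \<T>" and B: "B \<in> \<T>"
  shows "X \<in> \<T>"
proof (rule torsion_memI[OF tt])
  note fg = short_exactD[OF ex]
  show "X \<in> Obj C" using Hom_Obj[OF fg(2)] by simp
  fix F h assume F: "F \<in> \<F>" and h: "h \<in> Hom C X F"
  then have "zero_morphism C (h \<cdot> f)"
    using torsion_theory_zero_morphism[OF tt A] Comp_in_Hom[OF fg(1)] by blast
  then obtain k where k: "k \<in> Hom C B F" "h = k \<cdot> g"
    using ex1_implies_ex[OF short_exact_cokernel[OF ex h]] by blast
  then show "zero_morphism C h"
    using zero_morphism_Comp_right[OF torsion_theory_zero_morphism[OF tt B F k(1)] k(1) fg(2)]
    by simp
qed

text \<open>The sequence of the second theory for an object of \<open>\<T>\<^sub>1\<close> is the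
  required extension, as its right end is a quotient of that object. The reverse inclusion is
  closure of \<open>\<T>\<^sub>1\<close> under extensions.\<close>

lemma torsion_eq_extensions:
  assumes t1: "torsion_theory C \<T>\<^sub>1 \<F>\<^sub>1" and t2: "torsion_theory C \<T>\<^sub>2 \<F>\<^sub>2" and sub: "\<T>\<^sub>2 \<subseteq> \<T>\<^sub>1"
  shows "\<T>\<^sub>1 = extensions C \<T>\<^sub>2 (\<T>\<^sub>1 \<inter> \<F>\<^sub>2)"
proof
  show "\<T>\<^sub>1 \<subseteq> extensions C \<T>\<^sub>2 (\<T>\<^sub>1 \<inter> \<F>\<^sub>2)"
  proof
    fix X assume X: "X \<in> \<T>\<^sub>1"
    then have Xo: "X \<in> Obj C" using torsion_theory_Obj[OF t1] by blast
    obtain T F f g where "T \<in> \<T>\<^sub>2" "F \<in> \<F>\<^sub>2" and ex: "short_exact C T f X g F"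
      using torsion_theory_short_exact[OF t2 Xo] .
    moreover have "F \<in> \<T>\<^sub>1" using torsion_quotient[OF t1 ex X] .
    ultimately show "X \<in> extensions C \<T>\<^sub>2 (\<T>\<^sub>1 \<inter> \<F>\<^sub>2)"
      using Xo unfolding extensions_def by blast
  qed
  show "extensions C \<T>\<^sub>2 (\<T>\<^sub>1 \<inter> \<F>\<^sub>2) \<subseteq> \<T>\<^sub>1"
    using torsion_extension[OF t1] sub unfolding extensions_def by blast
qed

section \<open>The pretorsion theory built from two torsion theories, and the converse\<close>

lemma Hom_eq_Triv:
  assumes t1: "torsion_theory C \<T>\<^sub>1 \<F>\<^sub>1" and t2: "torsion_theory C \<T>\<^sub>2 \<F>\<^sub>2"
    and T: "T \<in> \<T>\<^sub>1" and F: "F \<in> \<F>\<^sub>2"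
  shows "Hom C T F = Triv C (\<T>\<^sub>1 \<inter> \<F>\<^sub>2) T F"
proof
  show "Triv C (\<T>\<^sub>1 \<inter> \<F>\<^sub>2) T F \<subseteq> Hom C T F" unfolding Triv_def by auto
  have To: "T \<in> Obj C" using T torsion_theory_Obj[OF t1] by blast
  obtain A B e g where A: "A \<in> \<T>\<^sub>2" and B: "B \<in> \<F>\<^sub>2" and ex: "short_exact C A e T g B"
    using torsion_theory_short_exact[OF t2 To] .
  note eg = short_exactD[OF ex]
  have Z: "B \<in> \<T>\<^sub>1 \<inter> \<F>\<^sub>2" using torsion_quotient[OF t1 ex T] B by blast
  show "Hom C T F \<subseteq> Triv C (\<T>\<^sub>1 \<inter> \<F>\<^sub>2) T F"
  proof
    fix f assume f: "f \<in> Hom C T F"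
    \<comment> \<open>This composite runs from \<open>\<T>\<^sub>2\<close> to
      \<open>\<F>\<^sub>2\<close>, so \<open>f\<close> factors through the cokernel \<open>g\<close>
      of \<open>e\<close>, whose codomain \<open>B\<close> is trivial.\<close>
    have "zero_morphism C (f \<cdot> e)"
      using torsion_theory_zero_morphism[OF t2 A F Comp_in_Hom[OF eg(1) f]] .
    then obtain k where "k \<in> Hom C B F" "f = k \<cdot> g"
      using ex1_implies_ex[OF short_exact_cokernel[OF ex f]] by blast
    then show "f \<in> Triv C (\<T>\<^sub>1 \<inter> \<F>\<^sub>2) T F"
      using f Z eg(2) unfolding Triv_def by blast
  qed
qed

text \<open>The claim reduces to \<open>f\<close> being an ordinary kernel of \<open>p\<close>:
  every \<open>l\<close> with \<open>g \<cdot> l\<close> trivial is killed by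
  \<open>p\<close>.\<close>

lemma is_Z_kernel_torsion_part:
  assumes t1: "torsion_theory C \<T>\<^sub>1 \<F>\<^sub>1" and t2: "torsion_theory C \<T>\<^sub>2 \<F>\<^sub>2" and sub: "\<F>\<^sub>1 \<subseteq> \<F>\<^sub>2"
    and T: "T \<in> \<T>\<^sub>1" and G: "G \<in> \<F>\<^sub>1" and ex1: "short_exact C T f X p G"
    and S: "S \<in> \<T>\<^sub>2" and F: "F \<in> \<F>\<^sub>2" and ex2: "short_exact C S e X g F"
  shows "is_Z_kernel C (\<T>\<^sub>1 \<inter> \<F>\<^sub>2) f g"
proof -
  note fp = short_exactD[OF ex1]
  note eg = short_exactD[OF ex2]
  have gf: "g \<cdot> f \<in> Hom C T F" using Comp_in_Hom[OF fp(1) eg(2)] .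
  then have triv: "trivial_morphism C (\<T>\<^sub>1 \<inter> \<F>\<^sub>2) (g \<cdot> f)"
    using Hom_eq_Triv[OF t1 t2 T F] HomD[OF gf] unfolding trivial_morphism_def by simp
  \<comment> \<open>The target \<open>G\<close> lies in \<open>\<F>\<^sub>2\<close> by the
    inclusion, so \<open>p\<close> kills the \<open>\<T>\<^sub>2\<close>-part \<open>e\<close> and
    factors through its cokernel \<open>g\<close>.\<close>
  have "zero_morphism C (p \<cdot> e)"
    using torsion_theory_zero_morphism[OF t2 S _ Comp_in_Hom[OF eg(1) fp(2)]] G sub by blast
  then obtain q where q: "q \<in> Hom C F G" "p = q \<cdot> g"
    using ex1_implies_ex[OF short_exact_cokernel[OF ex2 fp(2)]] by blast
  have "\<exists>!l'. l' \<in> Hom C Y T \<and> l = f \<cdot> l'"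
    if l: "l \<in> Hom C Y X" and tr: "trivial_morphism C (\<T>\<^sub>1 \<inter> \<F>\<^sub>2) (g \<cdot> l)" for l Y
  proof (rule short_exact_kernel[OF ex1 l])
    have gl: "g \<cdot> l \<in> Hom C Y F" using Comp_in_Hom[OF l eg(2)] .
    obtain Z h k where Z: "Z \<in> \<T>\<^sub>1" and h: "h \<in> Hom C Y Z" and k: "k \<in> Hom C Z F"
      and eq: "g \<cdot> l = k \<cdot> h"
      using tr HomD[OF gl] unfolding trivial_morphism_def Triv_def by auto
    have qk: "q \<cdot> k \<in> Hom C Z G" using Comp_in_Hom[OF k q(1)] .
    \<comment> \<open>Here \<open>q \<cdot> k\<close> goes from \<open>Z\<close> in
      \<open>\<T>\<^sub>1\<close> to \<open>G\<close> in \<open>\<F>\<^sub>1\<close>, hence is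
      zero.\<close>
    have "p \<cdot> l = (q \<cdot> k) \<cdot> h"
      using Comp_assoc[OF l eg(2) q(1)] Comp_assoc[OF h k q(1)] q(2) eq by simp
    then show "zero_morphism C (p \<cdot> l)"
      using zero_morphism_Comp_right[OF torsion_theory_zero_morphism[OF t1 Z G qk] qk h] by simp
  qed
  then show ?thesis
    unfolding is_Z_kernel_def
    using HomD[OF fp(1)] HomD[OF eg(2)] triv by (auto simp: Hom_def)
qed

lemma pretorsion_theoryI:
  assumes t1: "torsion_theory C \<T>\<^sub>1 \<F>\<^sub>1" and t2: "torsion_theory C \<T>\<^sub>2 \<F>\<^sub>2" and sub: "\<F>\<^sub>1 \<subseteq> \<F>\<^sub>2"
  shows "pretorsion_theory C \<T>\<^sub>1 \<F>\<^sub>2"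
proof -
  have "\<exists>T\<in>\<T>\<^sub>1. \<exists>F\<in>\<F>\<^sub>2. \<exists>f g. short_Z_exact C (\<T>\<^sub>1 \<inter> \<F>\<^sub>2) T f X g F" if X: "X \<in> Obj C" for X
  proof -
    obtain T G f p where T: "T \<in> \<T>\<^sub>1" and G: "G \<in> \<F>\<^sub>1" and ex1: "short_exact C T f X p G"
      using torsion_theory_short_exact[OF t1 X] .
    obtain S F e g where S: "S \<in> \<T>\<^sub>2" and F: "F \<in> \<F>\<^sub>2" and ex2: "short_exact C S e X g F"
      using torsion_theory_short_exact[OF t2 X] .
    have "is_Z_kernel C (\<T>\<^sub>1 \<inter> \<F>\<^sub>2) f g"
      using is_Z_kernel_torsion_part[OF t1 t2 sub T G ex1 S F ex2] .
    \<comment> \<open>Dual of the preceding fact: in the opposite category the two sequences trade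
      places, and the inclusion required there is
      \<open>\<T>\<^sub>2 \<subseteq> \<T>\<^sub>1\<close>.\<close>
    moreover have "is_Z_cokernel C (\<T>\<^sub>1 \<inter> \<F>\<^sub>2) g f"
      using pointed_category.is_Z_kernel_torsion_part[OF pointed_category_opposite,
          of \<F>\<^sub>2 \<T>\<^sub>2 \<F>\<^sub>1 \<T>\<^sub>1 F S g X e G T p f] t1 t2 sub torsion_subset_iff[OF t1 t2] T G ex1 S F ex2
      by (simp add: Int_commute)
    ultimately show ?thesis
      using T F short_exactD[OF ex1] short_exactD[OF ex2]
      unfolding short_Z_exact_def by blast
  qed
  then show ?thesis
    using t1 t2 Hom_eq_Triv[OF t1 t2] unfolding pretorsion_theory_def torsion_theory_def by simp
qed

text \<open>The argument of \<open>torsion_memI\<close> with a Z-kernel in place of a kernel: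
  \<open>f\<close> is shown to be an isomorphism from an object of
  \<open>\<T>\<^sub>1\<close>.\<close>

lemma torsion_subset_if_pretorsion_theory:
  assumes t1: "torsion_theory C \<T>\<^sub>1 \<F>\<^sub>1" and t2: "torsion_theory C \<T>\<^sub>2 \<F>\<^sub>2"
    and pt: "pretorsion_theory C \<T>\<^sub>1 \<F>\<^sub>2"
  shows "\<T>\<^sub>2 \<subseteq> \<T>\<^sub>1"
proof
  fix X assume X: "X \<in> \<T>\<^sub>2"
  then have Xo: "X \<in> Obj C" using torsion_theory_Obj[OF t2] by blast
  obtain T F f g where T: "T \<in> \<T>\<^sub>1" and F: "F \<in> \<F>\<^sub>2"
    and ex: "short_Z_exact C (\<T>\<^sub>1 \<inter> \<F>\<^sub>2) T f X g F"
    using pt Xo unfolding pretorsion_theory_def by blast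
  have f: "f \<in> Hom C T X" and g: "g \<in> Hom C X F" and ker: "is_Z_kernel C (\<T>\<^sub>1 \<inter> \<F>\<^sub>2) f g"
    using ex unfolding short_Z_exact_def by auto
  have id: "Ident C X \<in> Hom C X X" "Ident C T \<in> Hom C T T"
    using Ident_in_Hom Hom_Obj[OF f] by auto
  have kernel: "\<exists>!l'. l' \<in> Hom C Y T \<and> l = f \<cdot> l'"
    if "l \<in> Hom C Y X" "trivial_morphism C (\<T>\<^sub>1 \<inter> \<F>\<^sub>2) (g \<cdot> l)" for l Y
  proof -
    have "\<forall>l \<in> Arr C. Cod C l = Dom C g \<and> trivial_morphism C (\<T>\<^sub>1 \<inter> \<F>\<^sub>2) (g \<cdot> l) \<longrightarrow>
        (\<exists>!l'. l' \<in> Hom C (Dom C l) (Dom C f) \<and> l = f \<cdot> l')"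
      using ker unfolding is_Z_kernel_def by (elim conjE)
    from bspec[OF this HomD(1)[OF that(1)]] show ?thesis
      using HomD[OF f] HomD[OF g] HomD[OF that(1)] that(2) by simp
  qed
  \<comment> \<open>A zero arrow counts as Z-trivial only if a zero object belongs to both classes.
    It does, since all arrows out of it and into it are zero.\<close>
  obtain Z h k where Z: "zero_object C Z" and h: "h \<in> Hom C X Z" and k: "k \<in> Hom C Z F"
    and g_eq: "g = k \<cdot> h"
    using torsion_theory_zero_morphism[OF t2 X F g] HomD[OF g] unfolding zero_morphism_def by auto
  have Zo: "Z \<in> Obj C" using Z unfolding zero_object_def by blast
  have "Z \<in> \<T>\<^sub>1"
    using torsion_memI[OF t1 Zo zero_morphism_zero_object[OF Z]] .
  moreover have "Z \<in> \<F>\<^sub>2"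
    using pointed_category.torsion_memI[OF pointed_category_opposite, of \<F>\<^sub>2 \<T>\<^sub>2 Z]
      category.zero_morphism_zero_object[OF category_opposite, of Z] t2 Zo Z by simp
  ultimately have "trivial_morphism C (\<T>\<^sub>1 \<inter> \<F>\<^sub>2) g"
    using g h k g_eq HomD[OF g] unfolding trivial_morphism_def Triv_def by auto
  then obtain s where s: "s \<in> Hom C X T" "Ident C X = f \<cdot> s"
    using ex1_implies_ex[OF kernel[OF id(1)]] Comp_Ident[OF g] by auto
  have triv: "trivial_morphism C (\<T>\<^sub>1 \<inter> \<F>\<^sub>2) (g \<cdot> f)"
    using ker unfolding is_Z_kernel_def by (elim conjE)
  have "f = f \<cdot> (s \<cdot> f)"
    using Comp_assoc[OF f s(1) f] s(2) Ident_Comp[OF f] by simp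
  \<comment> \<open>Both arrows factor \<open>f\<close> through itself; since
    \<open>g \<cdot> f\<close> is trivial, the Z-kernel property makes such a factorisation
    unique.\<close>
  then have "s \<cdot> f = Ident C T"
    by (rule ex1_eq[OF kernel[OF f triv] conjI[OF Comp_in_Hom[OF f s(1)]] conjI[OF id(2)]])
      (simp add: Comp_Ident[OF f])
  then show "X \<in> \<T>\<^sub>1"
    using iso_closed_inverse_pair[OF _ T f s(1)] s(2) t1 unfolding torsion_theory_def by auto
qed

end

section \<open>The equivalences and the two extension formulas\<close>

theorem theorem2p1:
  fixes C :: "('o, 'a) category" and \<T>\<^sub>1 \<F>\<^sub>1 \<T>\<^sub>2 \<F>\<^sub>2 :: "'o set"
  assumes "pointed_category C"
    and "torsion_theory C \<T>\<^sub>1 \<F>\<^sub>1"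
    and "torsion_theory C \<T>\<^sub>2 \<F>\<^sub>2"
  shows "(\<T>\<^sub>2 \<subseteq> \<T>\<^sub>1 \<longleftrightarrow> \<F>\<^sub>1 \<subseteq> \<F>\<^sub>2)
    \<and> (\<F>\<^sub>1 \<subseteq> \<F>\<^sub>2 \<longleftrightarrow> pretorsion_theory C \<T>\<^sub>1 \<F>\<^sub>2)
    \<and> (\<T>\<^sub>2 \<subseteq> \<T>\<^sub>1 \<longrightarrow>
        \<T>\<^sub>1 = extensions C \<T>\<^sub>2 (\<T>\<^sub>1 \<inter> \<F>\<^sub>2) \<and> \<F>\<^sub>2 = extensions C (\<T>\<^sub>1 \<inter> \<F>\<^sub>2) \<F>\<^sub>1)"
proof -
  interpret pointed_category C by fact
  note iff = torsion_subset_iff[OF assms(2,3)]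
  \<comment> \<open>In the opposite category \<open>\<F>\<^sub>2\<close> is the larger torsion
    class, and extensions there have their two ends exchanged.\<close>
  have "\<F>\<^sub>2 = extensions C (\<T>\<^sub>1 \<inter> \<F>\<^sub>2) \<F>\<^sub>1" if "\<F>\<^sub>1 \<subseteq> \<F>\<^sub>2"
    using pointed_category.torsion_eq_extensions[OF pointed_category_opposite, of \<F>\<^sub>2 \<T>\<^sub>2 \<F>\<^sub>1 \<T>\<^sub>1]
      assms(2,3) that by (simp add: Int_commute)
  then show ?thesis
    using iff pretorsion_theoryI[OF assms(2,3)] torsion_subset_if_pretorsion_theory[OF assms(2,3)]
      torsion_eq_extensions[OF assms(2,3)] by blast
qed

end
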